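(* Let $A\in\mathbb{C}^{n\times n}$ and let $k$ be an integer with $0\le k\le n$. Then the following hold. \begin{itemize} \item If $A$ does not have the eigenvalue $-i$ and $A$ is a rank $k$ perturbation of a Hermitian matrix, then $\mathcal{C}(A)$ is a rank $k$ perturbation of a unitary matrix. Moreover, $\mathcal{C}(A)$ does not have the eigenvalue $1$. \item If $A$ does not have the eigenvalue $1$ and $A$ is a rank $k$ perturbation of a unitary matrix, then $\mathcal{C}^{-1}(A)$ is a rank $k$ perturbation of a Hermitian matrix. Moreover, $\mathcal{C}^{-1}(A)$ does not have the eigenvalue $-i$. \end{itemize}
   Context: $\mathcal{C}$ is the Cayley transform $\mathcal{C}(z) = \frac{z-i}{z+i}$ for $z\in\mathbb{C}\setminus\{-i\}$, with inverse $\mathcal{C}^{-1}(z) = i\cdot\frac{1+z}{1-z}$ for $z\in\mathbb{C}\setminus\{1\}$. Applied to matrices: $\mathcal{C}(A) = (A-iI)(A+iI)^{-1}$ when $-i$ is not an eigenvalue of $A$, and $\mathcal{C}^{-1}(A) = i\,(I+A)(I-A)^{-1}$ when $1$ is not an eigenvalue of $A$. A matrix $A$ is a rank $k$ perturbation of a Hermitian (resp. unitary) matrix if there exist a Hermitian (resp. unitary) matrix $M\in\mathbb{C}^{n\times n}$ and a matrix $E\in\mathbb{C}^{n\times n}$ with $\operatorname{rank}(E)=k$ such that $A=M+E$. *)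

theory Defs
  imports
    "Jordan_Normal_Form.Matrix"
    "Jordan_Normal_Form.Char_Poly"
    "Jordan_Normal_Form.Gauss_Jordan_Elimination"
    "Jordan_Normal_Form.Schur_Decomposition"
    "Jordan_Normal_Form.DL_Rank"
begin

definition hermitian :: "complex mat \<Rightarrow> bool" where
  "hermitian M \<longleftrightarrow> mat_adjoint M = M"

definition unitary :: "complex mat \<Rightarrow> bool" where
  "unitary M \<longleftrightarrow> square_mat M \<and> mat_adjoint M * M = 1\<^sub>m (dim_row M)"

definition rank_perturbation_of_hermitian :: "nat \<Rightarrow> nat \<Rightarrow> complex mat \<Rightarrow> bool" where
  "rank_perturbation_of_hermitian n k A \<longleftrightarrow>
     (\<exists>M \<in> carrier_mat n n. \<exists>E \<in> carrier_mat n n.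
        hermitian M \<and> vec_space.rank n E = k \<and> A = M + E)"

definition rank_perturbation_of_unitary :: "nat \<Rightarrow> nat \<Rightarrow> complex mat \<Rightarrow> bool" where
  "rank_perturbation_of_unitary n k A \<longleftrightarrow>
     (\<exists>M \<in> carrier_mat n n. \<exists>E \<in> carrier_mat n n.
        unitary M \<and> vec_space.rank n E = k \<and> A = M + E)"

(* "the (mat_inverse B)" is the inverse of B if B is invertible and unspecified otherwise.
   So cayley is meaningful only if -i is not an eigenvalue of A, and cayley_inverse only if
   1 is not an eigenvalue of A. *)

definition cayley :: "complex mat \<Rightarrow> complex mat" where
  "cayley A =
     (A - \<i> \<cdot>\<^sub>m 1\<^sub>m (dim_row A)) * the (mat_inverse (A + \<i> \<cdot>\<^sub>m 1\<^sub>m (dim_row A)))"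

definition cayley_inverse :: "complex mat \<Rightarrow> complex mat" where
  "cayley_inverse A =
     \<i> \<cdot>\<^sub>m ((1\<^sub>m (dim_row A) + A) * the (mat_inverse (1\<^sub>m (dim_row A) - A)))"

end

theory Submission imports Defs begin

text \<open>
  Both transforms are affine functions of an inverse:
  \<open>C(A) = I - 2i (A + iI)\<^sup>-\<^sup>1\<close> and \<open>C\<^sup>-\<^sup>1(A) = -iI + 2i (I - A)\<^sup>-\<^sup>1\<close>
  (\<open>cayley_eq\<close>, \<open>cayley_inverse_eq\<close>). The claims on eigenvalues follow at once: an invertible
  matrix plus \<open>aI\<close> does not have the eigenvalue \<open>a\<close>. The number \<open>k\<close> survives as an exact rank because
  in both cases the new perturbation is \<open>E\<close> multiplied from both sides by invertible matrices
  (\<open>rank_smult_mult_invertible\<close>).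

  Let \<open>A = H + E\<close> with \<open>H\<close> Hermitian. Then \<open>H + iI\<close> is invertible, \<open>C(H)\<close> is unitary, and
  \<open>C(A) - C(H)\<close> is a multiple of \<open>(A + iI)\<^sup>-\<^sup>1 - (H + iI)\<^sup>-\<^sup>1 = -(A + iI)\<^sup>-\<^sup>1 E (H + iI)\<^sup>-\<^sup>1\<close>.

  Let \<open>A = U + E\<close> with \<open>U\<close> unitary. Here \<open>U\<close> itself may have the eigenvalue \<open>1\<close>, so \<open>C\<^sup>-\<^sup>1(U)\<close> need
  not exist. Instead the skew part of \<open>B = C\<^sup>-\<^sup>1(A)\<close> is removed directly. With \<open>R = (I - A)\<^sup>-\<^sup>1\<close> it is
  given by \<open>B - B\<^sup>* = 2i (R + R\<^sup>* - I) = -2i R (A A\<^sup>* - I) R\<^sup>*\<close>. The defect of unitarity splits as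
  \<open>A A\<^sup>* - I = K + K\<^sup>*\<close> with \<open>K = E (U + cE)\<^sup>*\<close>, for every \<open>c\<close> with real part \<open>1/2\<close>, and therefore
  \<open>B + 2i R K R\<^sup>*\<close> is Hermitian. Its difference from \<open>B\<close> is a multiple of \<open>R E (U + cE)\<^sup>* R\<^sup>*\<close>, which
  has the rank of \<open>E\<close> as soon as \<open>U + cE\<close> is invertible. The choice \<open>c = 1/2\<close> can fail
  (\<open>U = 1\<close>, \<open>E = -2\<close>, \<open>n = 1\<close>), but the imaginary part of \<open>c\<close> is free and only finitely many values
  are bad (\<open>exists_invertible_on_line\<close>).
\<close>

section \<open>Rank and multiplication by invertible matrices\<close>

context vec_space
begin

text \<open>Products of matrices act on ranges by composition, so inequalities between ranks of products
  reduce to inclusions and images of these subspaces.\<close>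

lemma span_cols_eq_range:
  assumes A: "A \<in> carrier_mat n m"
  shows "span (set (cols A)) = (\<lambda>x. A *\<^sub>v x) ` carrier_vec m"
proof -
  have colsA: "set (cols A) \<subseteq> carrier_vec n"
    using cols_dim[of A] A by auto
  have comb: "lincomb_list c (cols A) = A *\<^sub>v vec m c" for c
    using colsA mat_of_cols_cols[of A] A by (subst lincomb_list_as_mat_mult) auto
  have "span_list (cols A) = (\<lambda>x. A *\<^sub>v x) ` carrier_vec m"
  proof (intro equalityI subsetI)
    fix v assume "v \<in> (\<lambda>x. A *\<^sub>v x) ` carrier_vec m"
    then obtain x where x: "x \<in> carrier_vec m" "v = A *\<^sub>v x" by auto
    have "vec m (\<lambda>i. x $ i) = x" using x by (intro eq_vecI) auto
    then show "v \<in> span_list (cols A)"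
      using x comb[of "\<lambda>i. x $ i"] by (intro in_span_listI[where c = "\<lambda>i. x $ i"]) auto
  qed (auto simp: span_list_def comb)
  then show ?thesis using span_list_as_span[OF colsA] by simp
qed

lemma rank_mult_right_le:
  assumes A: "A \<in> carrier_mat n m" and Q: "Q \<in> carrier_mat m l"
  shows "rank (A * Q) \<le> rank A"
proof -
  have AQ: "A * Q \<in> carrier_mat n l" using A Q by simp
  have colsA: "set (cols A) \<subseteq> carrier_vec n" and colsAQ: "set (cols (A * Q)) \<subseteq> carrier_vec n"
    using cols_dim[of A] cols_dim[of "A * Q"] A Q by auto
  have sub: "span (set (cols (A * Q))) \<subseteq> span (set (cols A))"
    unfolding span_cols_eq_range[OF A] span_cols_eq_range[OF AQ] using A Q by auto
  have "VectorSpace.subspace class_ring (span (set (cols (A * Q)))) (span_vs (set (cols A)))"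
    using nested_subspaces[OF span_is_subspace span_is_subspace sub] colsA colsAQ by simp
  moreover have "vectorspace class_ring (span_vs (set (cols A)))"
    using span_is_subspace[THEN subspace_is_vs] colsA by simp
  ultimately show ?thesis
    unfolding rank_def
    using vectorspace.subspace_dim[of class_ring "span_vs (set (cols A))"]
      fin_dim_span_cols[OF A] fin_dim_span_cols[OF AQ] by simp
qed

text \<open>The column space of \<open>P * A\<close> is the image of that of \<open>A\<close> under \<open>P\<close>, and linear maps do not
  increase the dimension.\<close>

lemma rank_mult_left_le:
  assumes P: "P \<in> carrier_mat n n" and A: "A \<in> carrier_mat n m"
  shows "rank (P * A) \<le> rank A"
proof -
  let ?T = "\<lambda>v. P *\<^sub>v v"
  have PA: "P * A \<in> carrier_mat n m" using A P by simp
  have colsA: "set (cols A) \<subseteq> carrier_vec n" using cols_dim[of A] A by auto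
  have vsA: "vectorspace class_ring (span_vs (set (cols A)))"
    using span_is_subspace[THEN subspace_is_vs] colsA by simp
  have spA: "span (set (cols A)) \<subseteq> carrier_vec n" using span_is_subset2 colsA by simp
  have "?T \<in> LinearCombinations.module_hom class_ring (span_vs (set (cols A))) V"
    unfolding LinearCombinations.module_hom_def
  proof (intro CollectI conjI allI impI, goal_cases)
    case 1
    show ?case using subsetD[OF spA] P by (intro funcsetI) simp
  next
    case (2 v w)
    then have "v \<in> carrier_vec n" "w \<in> carrier_vec n" using subsetD[OF spA] by simp_all
    then show ?case using mult_add_distrib_mat_vec[OF P, of v w] by simp
  next
    case (3 r v)
    then have "v \<in> carrier_vec n" using subsetD[OF spA] by simp
    then show ?case using mult_mat_vec[OF P, of v r] by simp
  qed
  then have "linear_map class_ring (span_vs (set (cols A))) V ?T"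
    unfolding linear_map_def mod_hom_def mod_hom_axioms_def
    using vsA vec_vs[of n] unfolding vectorspace_def by blast
  then interpret T: linear_map class_ring "span_vs (set (cols A))" V ?T .
  have "T.imT = span (set (cols (P * A)))"
    unfolding T.im_def span_cols_eq_range[OF PA] using P A
    by (auto simp: span_cols_eq_range[OF A] image_image)
  then show ?thesis
    using T.rank_nullity[OF fin_dim_span_cols[OF A]] unfolding rank_def by simp
qed

end

text \<open>Each law is restricted to square matrices of one size. Its premises then contain no dimension
  that the conclusion leaves undetermined, so the simplifier can discharge them once \<open>n\<close> is given.\<close>

lemmas square_mat_simps =
  mult_carrier_mat[of _ n n _ n] mult_add_distrib_mat[of _ n n _ n] add_mult_distrib_mat[of _ n n _ _ n]
  mult_minus_distrib_mat[of _ n n _ n] minus_mult_distrib_mat[of _ n n _ _ n]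
  mult_smult_distrib[of _ n n _ n] mult_smult_assoc_mat[of _ n n _ n]
  for n

lemma smult_one_mat [simp]: "1 \<cdot>\<^sub>m A = (A :: 'a :: monoid_mult mat)"
  by (intro eq_matI) auto

lemma smult_smult_mat:
  fixes A :: "'a :: semigroup_mult mat"
  shows "a \<cdot>\<^sub>m (b \<cdot>\<^sub>m A) = (a * b) \<cdot>\<^sub>m A"
  by (intro eq_matI) (auto simp: mult.assoc)

declare minus_carrier_mat [simp]

lemma rank_mult_invertible:
  fixes E :: "'a :: field mat"
  assumes P: "P \<in> carrier_mat n n" "P' \<in> carrier_mat n n" "P' * P = 1\<^sub>m n"
    and Q: "Q \<in> carrier_mat m m" "Q' \<in> carrier_mat m m" "Q * Q' = 1\<^sub>m m"
    and E: "E \<in> carrier_mat n m"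
  shows "vec_space.rank n (P * E * Q) = vec_space.rank n E"
proof (rule antisym)
  have "vec_space.rank n (P * E * Q) \<le> vec_space.rank n (P * E)"
    using vec_space.rank_mult_right_le P Q E by (metis mult_carrier_mat)
  also have "\<dots> \<le> vec_space.rank n E"
    using vec_space.rank_mult_left_le P E by metis
  finally show "vec_space.rank n (P * E * Q) \<le> vec_space.rank n E" .
  have "E = P' * P * E * (Q * Q')" using P Q E by simp
  also have "\<dots> = P' * ((P * E * Q) * Q')"
    using P(1,2) Q(1,2) E by (simp add: assoc_mult_mat[of _ n n _ n _ m] assoc_mult_mat[of _ n n _ m _ m]
      assoc_mult_mat[of _ n m _ m _ m])
  finally have eq: "E = P' * ((P * E * Q) * Q')" .
  have "vec_space.rank n E \<le> vec_space.rank n ((P * E * Q) * Q')"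
    by (subst eq, rule vec_space.rank_mult_left_le) (use P Q E in auto)
  also have "\<dots> \<le> vec_space.rank n (P * E * Q)"
    by (rule vec_space.rank_mult_right_le) (use P Q E in auto)
  finally show "vec_space.rank n E \<le> vec_space.rank n (P * E * Q)" .
qed

lemma rank_smult_mult_invertible:
  fixes E :: "'a :: field mat"
  assumes "a \<noteq> 0"
    and P: "P \<in> carrier_mat n n" "P' \<in> carrier_mat n n" "P' * P = 1\<^sub>m n"
    and Q: "Q \<in> carrier_mat m m" "Q' \<in> carrier_mat m m" "Q * Q' = 1\<^sub>m m"
    and E: "E \<in> carrier_mat n m"
  shows "vec_space.rank n (a \<cdot>\<^sub>m (P * E * Q)) = vec_space.rank n E"
proof -
  have "a \<cdot>\<^sub>m (P * E * Q) = (a \<cdot>\<^sub>m P) * E * Q"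
    using P Q E by (simp add: mult_smult_assoc_mat[of _ n m _ m] mult_smult_assoc_mat[of _ n n _ m])
  moreover have "(inverse a \<cdot>\<^sub>m P') * (a \<cdot>\<^sub>m P) = 1\<^sub>m n"
    using P \<open>a \<noteq> 0\<close>
    by (simp add: square_mat_simps[where n = n] smult_smult_mat)
  ultimately show ?thesis
    using rank_mult_invertible[of "a \<cdot>\<^sub>m P" n "inverse a \<cdot>\<^sub>m P'" Q m Q' E] P Q E by simp
qed

section \<open>The adjoint\<close>

lemma dim_mat_adjoint [simp]:
  "dim_row (mat_adjoint A) = dim_col A" "dim_col (mat_adjoint A) = dim_row A"
  by (simp_all add: mat_adjoint_def)

lemma index_mat_adjoint [simp]:
  "i < dim_col A \<Longrightarrow> j < dim_row A \<Longrightarrow> mat_adjoint A $$ (i, j) = conjugate (A $$ (j, i))"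
  by (simp add: mat_adjoint_def mat_of_rows_index)

lemma mat_adjoint_carrier [simp]:
  "A \<in> carrier_mat n m \<Longrightarrow> mat_adjoint A \<in> carrier_mat m n"
  by (intro carrier_matI) auto

lemma mat_adjoint_adjoint [simp]: "mat_adjoint (mat_adjoint A) = A"
  by (intro eq_matI) auto

lemma mat_adjoint_one [simp]: "mat_adjoint (1\<^sub>m n :: complex mat) = 1\<^sub>m n"
  by (intro eq_matI) auto

lemma mat_adjoint_add:
  "A \<in> carrier_mat n m \<Longrightarrow> B \<in> carrier_mat n m \<Longrightarrow>
    mat_adjoint (A + B) = mat_adjoint A + mat_adjoint B"
  by (intro eq_matI) (auto simp: conjugate_dist_add)

lemma mat_adjoint_minus:
  fixes A :: "complex mat"
  shows "A \<in> carrier_mat n m \<Longrightarrow> B \<in> carrier_mat n m \<Longrightarrow>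
    mat_adjoint (A - B) = mat_adjoint A - mat_adjoint B"
  by (intro eq_matI) auto

lemma mat_adjoint_smult: "mat_adjoint (c \<cdot>\<^sub>m A) = conjugate c \<cdot>\<^sub>m mat_adjoint A"
  by (intro eq_matI) (auto simp: conjugate_dist_mul)

lemma mat_adjoint_mult:
  fixes A B :: "'a :: conjugatable_field mat"
  assumes "A \<in> carrier_mat n m" "B \<in> carrier_mat m l"
  shows "mat_adjoint (A * B) = mat_adjoint B * mat_adjoint A"
  using assms
  by (intro eq_matI)
    (auto simp: scalar_prod_def sum_conjugate conjugate_dist_mul mult.commute intro!: sum.cong)

section \<open>Inverses and eigenvalues\<close>

lemma the_mat_inverse:
  fixes N :: "'a :: field mat"
  assumes N: "N \<in> carrier_mat n n" and "det N \<noteq> 0"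
  shows "the (mat_inverse N) \<in> carrier_mat n n"
    "N * the (mat_inverse N) = 1\<^sub>m n" "the (mat_inverse N) * N = 1\<^sub>m n"
proof -
  have "mat_inverse N \<noteq> None"
    using mat_inverse(1)[OF N] det_non_zero_imp_unit[OF N \<open>det N \<noteq> 0\<close>] by metis
  then obtain B where "mat_inverse N = Some B" by auto
  with mat_inverse(2)[OF N this] show
    "the (mat_inverse N) \<in> carrier_mat n n"
    "N * the (mat_inverse N) = 1\<^sub>m n" "the (mat_inverse N) * N = 1\<^sub>m n" by auto
qed

lemma not_eigenvalue_shift_of_invertible:
  fixes R :: "'a :: field mat"
  assumes R: "R \<in> carrier_mat n n" and N: "N \<in> carrier_mat n n" "N * R = 1\<^sub>m n" and "b \<noteq> 0"
  shows "\<not> eigenvalue (a \<cdot>\<^sub>m 1\<^sub>m n + b \<cdot>\<^sub>m R) a"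
proof
  assume "eigenvalue (a \<cdot>\<^sub>m 1\<^sub>m n + b \<cdot>\<^sub>m R) a"
  moreover have "char_matrix (a \<cdot>\<^sub>m 1\<^sub>m n + b \<cdot>\<^sub>m R) a = b \<cdot>\<^sub>m R"
    using R by (intro eq_matI) (auto simp: char_matrix_def)
  ultimately have "det (b \<cdot>\<^sub>m R) = 0"
    using eigenvalue_det[of "a \<cdot>\<^sub>m 1\<^sub>m n + b \<cdot>\<^sub>m R" n a] R by simp
  then have "det R = 0" using \<open>b \<noteq> 0\<close> by (simp add: det_smult)
  then show False using det_mult[OF N(1) R] N(2) by simp
qed

text \<open>If \<open>Hv = ev\<close>, then \<open>\<langle>Hv, v\<rangle> = e \<langle>v, v\<rangle>\<close>, where both inner products are real
  and \<open>\<langle>v, v\<rangle>\<close> is not zero.\<close>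

lemma hermitian_not_eigenvalue:
  assumes H: "H \<in> carrier_mat n n" and "hermitian H" and "cnj e \<noteq> e"
  shows "\<not> eigenvalue H e"
proof
  assume "eigenvalue H e"
  then obtain v where v: "v \<in> carrier_vec n" "v \<noteq> 0\<^sub>v n" and Hv: "H *\<^sub>v v = e \<cdot>\<^sub>v v"
    using H unfolding eigenvalue_def eigenvector_def by auto
  have sym: "cnj (H $$ (i, j)) = H $$ (j, i)" if "i < n" "j < n" for i j
    using index_mat_adjoint[of j H i] \<open>hermitian H\<close> H that
    by (simp add: hermitian_def del: index_mat_adjoint)
  have eq: "(\<Sum>i<n. (\<Sum>j<n. H $$ (i, j) * v $ j) * cnj (v $ i)) = (H *\<^sub>v v) \<bullet>c v"
    using H v(1) by (simp add: scalar_prod_def atLeast0LessThan)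
  have "cnj ((H *\<^sub>v v) \<bullet>c v) = (\<Sum>i<n. \<Sum>j<n. H $$ (j, i) * cnj (v $ j) * v $ i)"
    unfolding eq[symmetric] by (simp add: sum_distrib_right sum_distrib_left sym mult.assoc)
  also have "\<dots> = (\<Sum>j<n. \<Sum>i<n. H $$ (j, i) * cnj (v $ j) * v $ i)" by (rule sum.swap)
  also have "\<dots> = (H *\<^sub>v v) \<bullet>c v"
    unfolding eq[symmetric] by (simp add: sum_distrib_right sum_distrib_left mult_ac)
  finally have "cnj ((H *\<^sub>v v) \<bullet>c v) = (H *\<^sub>v v) \<bullet>c v" .
  moreover have "(H *\<^sub>v v) \<bullet>c v = e * (v \<bullet>c v)" using v Hv by simp
  moreover have "cnj (v \<bullet>c v) = v \<bullet>c v"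
    using v(1) by (simp add: scalar_prod_def mult.commute)
  moreover have "v \<bullet>c v \<noteq> 0" using v conjugate_square_eq_0_vec by metis
  ultimately show False using \<open>cnj e \<noteq> e\<close> by simp
qed

text \<open>From \<open>V (U + cE) = c (c\<^sup>-\<^sup>1 I + VE)\<close> it follows that \<open>U + cE\<close> is singular only if \<open>-c\<^sup>-\<^sup>1\<close> is one of
  the finitely many eigenvalues of \<open>VE\<close>, while the line has infinitely many points. The line in
  question is the one on which \<open>c + cnj c = 1\<close>, as \<open>unitary_perturbation_defect\<close> requires.\<close>

lemma exists_invertible_on_line:
  assumes U: "U \<in> carrier_mat n n" "V \<in> carrier_mat n n" "V * U = 1\<^sub>m n"
    and E: "E \<in> carrier_mat n n"
  obtains c :: complex where "Re c = 1 / 2" "det (U + c \<cdot>\<^sub>m E) \<noteq> 0"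
proof -
  let ?c = "\<lambda>t. Complex (1 / 2) t"
  have VE: "V * E \<in> carrier_mat n n" using U E by simp
  have c0: "?c t \<noteq> 0" for t by (simp add: complex_eq_iff)
  have "finite {k. poly (char_poly (V * E)) k = 0}"
    using degree_monic_char_poly[OF VE] by (intro poly_roots_finite) auto
  then have fin: "finite {k. eigenvalue (V * E) k}"
    by (simp add: eigenvalue_root_char_poly[OF VE])
  have "inj (\<lambda>t. - inverse (?c t))" by (auto simp: inj_on_def)
  then have "finite ((\<lambda>t. - inverse (?c t)) -` {k. eigenvalue (V * E) k})"
    using finite_vimageI[OF fin] by blast
  then obtain t where t: "\<not> eigenvalue (V * E) (- inverse (?c t))"
    using ex_new_if_finite[OF infinite_UNIV_char_0[where 'a = real]] by blast
  have "V * (U + ?c t \<cdot>\<^sub>m E) = 1\<^sub>m n + ?c t \<cdot>\<^sub>m (V * E)"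
    using U E by (simp add: square_mat_simps[where n = n])
  also have "\<dots> = ?c t \<cdot>\<^sub>m char_matrix (V * E) (- inverse (?c t))"
    using U E c0[of t] by (intro eq_matI) (auto simp: char_matrix_def algebra_simps simp del: index_mult_mat(1))
  finally have "det (V * (U + ?c t \<cdot>\<^sub>m E)) \<noteq> 0"
    using t c0[of t] by (simp add: eigenvalue_det[OF VE] det_smult)
  then have "det (U + ?c t \<cdot>\<^sub>m E) \<noteq> 0" using det_mult[of V n "U + ?c t \<cdot>\<^sub>m E"] U E by auto
  then show ?thesis using that[of "?c t"] by simp
qed

text \<open>The resolvent identity turns a perturbation of a matrix into one of its inverse, with invertible
  factors on both sides. Applied to a matrix and its adjoint it also yields unitarity below.\<close>

lemma inverse_diff_eq:
  fixes N M :: "'a :: field mat"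
  assumes N: "N \<in> carrier_mat n n" "R \<in> carrier_mat n n" "R * N = 1\<^sub>m n"
    and M: "M \<in> carrier_mat n n" "S \<in> carrier_mat n n" "M * S = 1\<^sub>m n"
  shows "S - R = R * (N - M) * S"
proof -
  have "R * (N - M) * S = (R * N) * S - R * (M * S)"
    using N(1,2) M(1,2)
    by (simp add: square_mat_simps[where n = n] assoc_mult_mat[of _ n n _ n _ n])
  then show ?thesis using N M by simp
qed

section \<open>The Cayley transforms\<close>

text \<open>The resolvent identity for \<open>M = H + iI\<close> and \<open>M\<^sup>* = H - iI\<close> expresses \<open>S\<^sup>*S\<close> through \<open>S - S\<^sup>*\<close>, and this
  cancels the linear terms in \<open>(I - 2iS)\<^sup>* (I - 2iS)\<close>.\<close>

lemma unitary_cayley_of_hermitian: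
  assumes H: "H \<in> carrier_mat n n" "hermitian H"
    and S: "S \<in> carrier_mat n n" "(H + \<i> \<cdot>\<^sub>m 1\<^sub>m n) * S = 1\<^sub>m n"
  shows "unitary (1\<^sub>m n + (- 2 * \<i>) \<cdot>\<^sub>m S)"
proof -
  let ?M = "H + \<i> \<cdot>\<^sub>m 1\<^sub>m n" and ?S = "mat_adjoint S"
  have M: "?M \<in> carrier_mat n n" using H by simp
  have adj: "mat_adjoint ?M = H + (- \<i>) \<cdot>\<^sub>m 1\<^sub>m n"
    using H by (simp add: mat_adjoint_add[of _ n n] mat_adjoint_smult hermitian_def)
  have "?S * mat_adjoint ?M = 1\<^sub>m n"
    using mat_adjoint_mult[OF M S(1)] S(2) by simp
  then have "S - ?S = ?S * (mat_adjoint ?M - ?M) * S"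
    using inverse_diff_eq[of "mat_adjoint ?M" n ?S ?M S] M S by simp
  also have "mat_adjoint ?M - ?M = (- 2 * \<i>) \<cdot>\<^sub>m 1\<^sub>m n"
    unfolding adj using H by (intro eq_matI) auto
  also have "?S * ((- 2 * \<i>) \<cdot>\<^sub>m 1\<^sub>m n) * S = (- 2 * \<i>) \<cdot>\<^sub>m (?S * S)"
    using S by (simp add: square_mat_simps[where n = n])
  finally have "(\<i> / 2) \<cdot>\<^sub>m (S - ?S) = ?S * S"
    by (simp add: smult_smult_mat)
  note SS = this[symmetric]
  have "mat_adjoint (1\<^sub>m n + (- 2 * \<i>) \<cdot>\<^sub>m S) * (1\<^sub>m n + (- 2 * \<i>) \<cdot>\<^sub>m S)
      = (1\<^sub>m n + (2 * \<i>) \<cdot>\<^sub>m ?S) * (1\<^sub>m n + (- 2 * \<i>) \<cdot>\<^sub>m S)"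
    using S by (simp add: mat_adjoint_add[of _ n n] mat_adjoint_smult)
  also have "\<dots> = 1\<^sub>m n + (2 * \<i>) \<cdot>\<^sub>m ?S + (- 2 * \<i>) \<cdot>\<^sub>m (S + (2 * \<i>) \<cdot>\<^sub>m (?S * S))"
    using S by (simp add: square_mat_simps[where n = n] smult_smult_mat)
  also have "\<dots> = 1\<^sub>m n"
    unfolding SS using S(1) by (intro eq_matI) (auto simp: algebra_simps simp del: index_mult_mat(1))
  finally show ?thesis
    using S by (simp add: unitary_def)
qed

lemma cayley_eq:
  assumes A: "A \<in> carrier_mat n n" and "det (A + \<i> \<cdot>\<^sub>m 1\<^sub>m n) \<noteq> 0"
  shows "cayley A = 1\<^sub>m n + (- 2 * \<i>) \<cdot>\<^sub>m the (mat_inverse (A + \<i> \<cdot>\<^sub>m 1\<^sub>m n))"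
proof -
  define N where "N = A + \<i> \<cdot>\<^sub>m 1\<^sub>m n"
  have N: "N \<in> carrier_mat n n" using A by (simp add: N_def)
  note R = the_mat_inverse[OF N, OF assms(2)[folded N_def]]
  have "A - \<i> \<cdot>\<^sub>m 1\<^sub>m n = N + (- 2 * \<i>) \<cdot>\<^sub>m 1\<^sub>m n"
    using A unfolding N_def by (intro eq_matI) auto
  then show ?thesis
    using A N R by (simp add: cayley_def flip: N_def) (simp add: square_mat_simps[where n = n])
qed

lemma cayley_inverse_eq:
  assumes A: "A \<in> carrier_mat n n" and "det (1\<^sub>m n - A) \<noteq> 0"
  shows "cayley_inverse A = (- \<i>) \<cdot>\<^sub>m 1\<^sub>m n + (2 * \<i>) \<cdot>\<^sub>m the (mat_inverse (1\<^sub>m n - A))"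
proof -
  define N where "N = 1\<^sub>m n - A"
  have N: "N \<in> carrier_mat n n" using A by (simp add: N_def)
  note R = the_mat_inverse[OF N, OF assms(2)[folded N_def]]
  have "1\<^sub>m n + A = 2 \<cdot>\<^sub>m 1\<^sub>m n - N"
    using A unfolding N_def by (intro eq_matI) auto
  then have "cayley_inverse A = \<i> \<cdot>\<^sub>m (2 \<cdot>\<^sub>m the (mat_inverse N) - 1\<^sub>m n)"
    using A N R by (simp add: cayley_inverse_def flip: N_def) (simp add: square_mat_simps[where n = n])
  also have "\<dots> = (- \<i>) \<cdot>\<^sub>m 1\<^sub>m n + (2 * \<i>) \<cdot>\<^sub>m the (mat_inverse N)"
    using R by (intro eq_matI) (auto simp: algebra_simps)
  finally show ?thesis by (simp add: N_def)
qed

text \<open>The first two summands are \<open>C\<^sup>-\<^sup>1(A)\<close>. Any \<open>K\<close> whose Hermitian part is half the defect \<open>A A\<^sup>* - I\<close> yields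
  a correction that makes \<open>C\<^sup>-\<^sup>1(A)\<close> Hermitian. For \<open>N = I - A\<close> the defect equals
  \<open>N N\<^sup>* - N - N\<^sup>*\<close>, and conjugation by \<open>R = N\<^sup>-\<^sup>1\<close> turns this into \<open>I - R\<^sup>* - R\<close>.\<close>

lemma hermitian_cayley_inverse_corrected:
  assumes A: "A \<in> carrier_mat n n"
    and R: "R \<in> carrier_mat n n" "R * (1\<^sub>m n - A) = 1\<^sub>m n"
    and K: "K \<in> carrier_mat n n" "K + mat_adjoint K = A * mat_adjoint A - 1\<^sub>m n"
  shows "hermitian ((- \<i>) \<cdot>\<^sub>m 1\<^sub>m n + (2 * \<i>) \<cdot>\<^sub>m R + (2 * \<i>) \<cdot>\<^sub>m (R * K * mat_adjoint R))"
proof -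
  let ?N = "1\<^sub>m n - A" and ?R = "mat_adjoint R" and ?K = "mat_adjoint K"
  let ?Q = "R * K * ?R" and ?Q' = "R * ?K * ?R"
  have N: "?N \<in> carrier_mat n n" using A by simp
  have NR: "mat_adjoint ?N * ?R = 1\<^sub>m n"
    using mat_adjoint_mult[OF R(1) N] R(2) by simp
  have Q: "?Q \<in> carrier_mat n n" "?Q' \<in> carrier_mat n n"
    using R(1) K(1) by (simp_all add: square_mat_simps[where n = n])
  have adjQ: "mat_adjoint ?Q = ?Q'"
    using R(1) K(1)
    by (simp add: square_mat_simps[where n = n] mat_adjoint_mult[of _ n n _ n]
        assoc_mult_mat[of _ n n _ n _ n])
  have "?N * mat_adjoint ?N - ?N - mat_adjoint ?N = A * mat_adjoint A - 1\<^sub>m n"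
  proof -
    have "mat_adjoint ?N = 1\<^sub>m n - mat_adjoint A"
      using A by (simp add: mat_adjoint_minus[of _ n n])
    then have "?N * mat_adjoint ?N = 1\<^sub>m n - A - (mat_adjoint A - A * mat_adjoint A)"
      using A by (simp add: square_mat_simps[where n = n])
    then show ?thesis
      using A \<open>mat_adjoint ?N = _\<close> by (intro eq_matI) (auto simp del: index_mult_mat(1))
  qed
  then have "?Q + ?Q' = R * (?N * mat_adjoint ?N - ?N - mat_adjoint ?N) * ?R"
    using R(1) K(1) by (simp add: K(2)[symmetric] square_mat_simps[where n = n])
  also have "\<dots> = (R * ?N) * (mat_adjoint ?N * ?R) - (R * ?N) * ?R - R * (mat_adjoint ?N * ?R)"
    using R(1) N by (simp add: square_mat_simps[where n = n] assoc_mult_mat[of _ n n _ n _ n])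
  also have "\<dots> = 1\<^sub>m n - ?R - R"
    using R NR by simp
  finally have sum: "?Q + ?Q' = 1\<^sub>m n - ?R - R" .
  have Q': "?Q' = 1\<^sub>m n - ?R - R - ?Q"
    unfolding sum[symmetric] using Q by (intro eq_matI) (auto simp del: index_mult_mat(1))
  have "mat_adjoint ((- \<i>) \<cdot>\<^sub>m 1\<^sub>m n + (2 * \<i>) \<cdot>\<^sub>m R + (2 * \<i>) \<cdot>\<^sub>m ?Q)
      = \<i> \<cdot>\<^sub>m 1\<^sub>m n + (- 2 * \<i>) \<cdot>\<^sub>m ?R + (- 2 * \<i>) \<cdot>\<^sub>m ?Q'"
    using R(1) Q by (simp add: mat_adjoint_add[of _ n n] mat_adjoint_smult adjQ)
  also have "\<dots> = (- \<i>) \<cdot>\<^sub>m 1\<^sub>m n + (2 * \<i>) \<cdot>\<^sub>m R + (2 * \<i>) \<cdot>\<^sub>m ?Q"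
    unfolding Q' using R(1) Q by (intro eq_matI) (auto simp: algebra_simps simp del: index_mult_mat(1))
  finally show ?thesis unfolding hermitian_def .
qed

text \<open>As \<open>U U\<^sup>* = I\<close>, the defect is \<open>E U\<^sup>* + U E\<^sup>* + E E\<^sup>*\<close>. The condition on \<open>c\<close> distributes the self-adjoint
  term \<open>E E\<^sup>*\<close> over \<open>K\<close> and \<open>K\<^sup>*\<close>, with the weights \<open>cnj c\<close> and \<open>c\<close>, which add up to \<open>1\<close>. The factor \<open>E\<close> can
  be split off from the left of \<open>K\<close>, which bounds its rank by that of \<open>E\<close>.\<close>

lemma unitary_perturbation_defect:
  assumes U: "U \<in> carrier_mat n n" "unitary U" and E: "E \<in> carrier_mat n n" and c: "Re c = 1 / 2"
  defines "K \<equiv> E * mat_adjoint (U + c \<cdot>\<^sub>m E)"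
  shows "K + mat_adjoint K = (U + E) * mat_adjoint (U + E) - 1\<^sub>m n"
proof -
  let ?U = "mat_adjoint U" and ?E = "mat_adjoint E"
  have UU: "U * ?U = 1\<^sub>m n"
    using mat_mult_left_right_inverse[of ?U n U] U by (simp add: unitary_def)
  have K: "K = E * ?U + cnj c \<cdot>\<^sub>m (E * ?E)"
    unfolding K_def using U E
    by (simp add: mat_adjoint_add[of _ n n] mat_adjoint_smult square_mat_simps[where n = n])
  have K': "mat_adjoint K = U * ?E + c \<cdot>\<^sub>m (E * ?E)"
    unfolding K using U E
    by (simp add: mat_adjoint_add[of _ n n] mat_adjoint_smult mat_adjoint_mult[of _ n n _ n])
  have AA: "(U + E) * mat_adjoint (U + E) = 1\<^sub>m n + E * ?U + (U * ?E + E * ?E)"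
    using U E UU by (simp add: mat_adjoint_add[of _ n n] square_mat_simps[where n = n])
  have "x * c + x * cnj c = x" for x
    using c by (simp add: complex_eq_iff algebra_simps)
  then have cx: "c * x + (cnj c * x) = x" for x
    by (metis mult.commute)
  show ?thesis
    unfolding K' AA unfolding K using U E
    by (intro eq_matI) (auto simp: cx algebra_simps simp del: index_mult_mat(1))
qed

theorem lemma16:
  fixes A :: "complex mat" and n k :: nat
  assumes "A \<in> carrier_mat n n" and "k \<le> n"
  shows "(\<not> eigenvalue A (- \<i>) \<and> rank_perturbation_of_hermitian n k A \<longrightarrow>
            rank_perturbation_of_unitary n k (cayley A) \<and> \<not> eigenvalue (cayley A) 1) \<and>
         (\<not> eigenvalue A 1 \<and> rank_perturbation_of_unitary n k A \<longrightarrow>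
            rank_perturbation_of_hermitian n k (cayley_inverse A) \<and>
            \<not> eigenvalue (cayley_inverse A) (- \<i>))"
proof (intro conjI[of "_ \<longrightarrow> _"] impI; elim conjE)
  note A = assms(1)
  assume ev: "\<not> eigenvalue A (- \<i>)" and "rank_perturbation_of_hermitian n k A"
  then obtain H E where H: "H \<in> carrier_mat n n" "hermitian H"
    and E: "E \<in> carrier_mat n n" "vec_space.rank n E = k" and AHE: "A = H + E"
    unfolding rank_perturbation_of_hermitian_def by blast
  let ?N = "A + \<i> \<cdot>\<^sub>m 1\<^sub>m n" and ?M = "H + \<i> \<cdot>\<^sub>m 1\<^sub>m n"
  have N: "?N \<in> carrier_mat n n" and M: "?M \<in> carrier_mat n n" using A H by simp_all
  have detN: "det ?N \<noteq> 0"
    using ev A by (simp add: eigenvalue_det[OF A] char_matrix_def)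
  have "det ?M \<noteq> 0"
    using hermitian_not_eigenvalue[OF H, of "- \<i>"] H(1)
    by (simp add: eigenvalue_det[OF H(1)] char_matrix_def)
  define R where "R = the (mat_inverse ?N)"
  define S where "S = the (mat_inverse ?M)"
  note R = the_mat_inverse[OF N detN, folded R_def]
  note S = the_mat_inverse[OF M \<open>det ?M \<noteq> 0\<close>, folded S_def]
  let ?U = "1\<^sub>m n + (- 2 * \<i>) \<cdot>\<^sub>m S"
  have C: "cayley A = 1\<^sub>m n + (- 2 * \<i>) \<cdot>\<^sub>m R" using cayley_eq[OF A detN] by (simp add: R_def)
  have "?N - ?M = E" unfolding AHE using H E by (intro eq_matI) auto
  then have "S - R = R * E * S"
    using inverse_diff_eq[OF N R(1,3) M S(1,2)] by simp
  then have RES: "cayley A = ?U + (2 * \<i>) \<cdot>\<^sub>m (R * E * S)"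
    unfolding C using R(1) S(1) by (simp flip: \<open>S - R = _\<close>) (intro eq_matI, auto simp: algebra_simps)
  have rk: "vec_space.rank n ((2 * \<i>) \<cdot>\<^sub>m (R * E * S)) = k"
    using rank_smult_mult_invertible[of "2 * \<i>" R n ?N S n ?M E] R S N M E by simp
  have unit: "unitary ?U" using unitary_cayley_of_hermitian[OF H S(1,2)] .
  have "rank_perturbation_of_unitary n k (cayley A)"
    unfolding rank_perturbation_of_unitary_def
    by (rule bexI[of _ ?U], rule bexI[of _ "(2 * \<i>) \<cdot>\<^sub>m (R * E * S)"])
      (use RES rk unit R(1) S(1) E(1) in \<open>simp_all add: square_mat_simps(1)[where n = n]\<close>)
  moreover have "\<not> eigenvalue (cayley A) 1"
    using not_eigenvalue_shift_of_invertible[OF R(1) N R(2), of "- 2 * \<i>" 1] C by simp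
  ultimately show "rank_perturbation_of_unitary n k (cayley A) \<and> \<not> eigenvalue (cayley A) 1" ..
next
  note A = assms(1)
  assume ev: "\<not> eigenvalue A 1" and "rank_perturbation_of_unitary n k A"
  then obtain U E where U: "U \<in> carrier_mat n n" "unitary U"
    and E: "E \<in> carrier_mat n n" "vec_space.rank n E = k" and AUE: "A = U + E"
    unfolding rank_perturbation_of_unitary_def by blast
  let ?N = "1\<^sub>m n - A"
  have N: "?N \<in> carrier_mat n n" using A by simp
  have "?N = (- 1) \<cdot>\<^sub>m char_matrix A 1" using A by (intro eq_matI) (auto simp: char_matrix_def)
  then have detN: "det ?N \<noteq> 0"
    using ev by (simp add: eigenvalue_det[OF A] det_smult)
  define R where "R = the (mat_inverse ?N)"
  note R = the_mat_inverse[OF N detN, folded R_def]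
  have C: "cayley_inverse A = (- \<i>) \<cdot>\<^sub>m 1\<^sub>m n + (2 * \<i>) \<cdot>\<^sub>m R"
    using cayley_inverse_eq[OF A detN] by (simp add: R_def)
  obtain c where c: "Re c = 1 / 2" "det (U + c \<cdot>\<^sub>m E) \<noteq> 0"
    using exists_invertible_on_line[OF U(1) _ _ E(1), of "mat_adjoint U"] U by (auto simp: unitary_def)
  define W where "W = U + c \<cdot>\<^sub>m E"
  have W: "W \<in> carrier_mat n n" "det W \<noteq> 0" using U E c by (simp_all add: W_def)
  define K where "K = E * mat_adjoint W"
  have K: "K \<in> carrier_mat n n" "K + mat_adjoint K = A * mat_adjoint A - 1\<^sub>m n"
    using unitary_perturbation_defect[OF U E(1) c(1)] W E by (simp_all add: K_def W_def AUE)
  let ?H = "(- \<i>) \<cdot>\<^sub>m 1\<^sub>m n + (2 * \<i>) \<cdot>\<^sub>m R + (2 * \<i>) \<cdot>\<^sub>m (R * K * mat_adjoint R)"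
  let ?F = "(- 2 * \<i>) \<cdot>\<^sub>m (R * E * (mat_adjoint W * mat_adjoint R))"
  have herm: "hermitian ?H" using hermitian_cayley_inverse_corrected[OF A R(1,3) K] .
  have RKR: "R * K * mat_adjoint R = R * E * (mat_adjoint W * mat_adjoint R)"
    using R(1) E W by (simp add: K_def square_mat_simps[where n = n] assoc_mult_mat[of _ n n _ n _ n])
  have CH: "cayley_inverse A = ?H + ?F"
    unfolding C RKR using R(1) E(1) W
    by (intro eq_matI) (auto simp: algebra_simps simp del: index_mult_mat(1))
  note V = the_mat_inverse[OF W]
  let ?V = "the (mat_inverse W)"
  have "(mat_adjoint W * mat_adjoint R) * (mat_adjoint ?N * mat_adjoint ?V)
      = mat_adjoint (?V * (?N * R) * W)"
    using R(1) N V(1) W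
    by (simp add: square_mat_simps[where n = n] mat_adjoint_mult[of _ n n _ n]
        assoc_mult_mat[of _ n n _ n _ n])
  also have "\<dots> = 1\<^sub>m n" using R V W by simp
  finally have rk: "vec_space.rank n ?F = k"
    using rank_smult_mult_invertible[of "- 2 * \<i>" R n ?N "mat_adjoint W * mat_adjoint R" n
        "mat_adjoint ?N * mat_adjoint ?V" E] R N W V E
    by (simp add: square_mat_simps(1)[where n = n] del: assoc_mult_mat)
  have "rank_perturbation_of_hermitian n k (cayley_inverse A)"
    unfolding rank_perturbation_of_hermitian_def
    by (rule bexI[of _ ?H], rule bexI[of _ ?F])
      (use CH herm rk R(1) K(1) E(1) W(1) in \<open>simp_all add: square_mat_simps(1)[where n = n]\<close>)
  moreover have "\<not> eigenvalue (cayley_inverse A) (- \<i>)"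
    using not_eigenvalue_shift_of_invertible[OF R(1) N R(2), of "2 * \<i>" "- \<i>"] C by simp
  ultimately show "rank_perturbation_of_hermitian n k (cayley_inverse A) \<and>
      \<not> eigenvalue (cayley_inverse A) (- \<i>)" ..
qed

end
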